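(* Work over $\mathbb{Q}$. Every multilinear polynomial identity of degree 4 satisfied by the anti-tetrad $[a,b,c,d]=abcd-dcba$ in every associative algebra is a consequence of the skew-symmetry $[a,b,c,d]+[d,c,b,a]\equiv 0$.
   Context: A quaternary algebra is a vector space with one quadrilinear operation $[-,-,-,-]$. In degree 4, a multilinear polynomial in variables $a,b,c,d$ is a $\mathbb{Q}$-linear combination of the 24 monomials $[x_1,x_2,x_3,x_4]$ where $(x_1,\dots,x_4)$ is a permutation of $(a,b,c,d)$. Such a polynomial $I$ is a multilinear identity satisfied by the anti-tetrad if it becomes 0 in the free associative algebra when $[x_1,x_2,x_3,x_4]$ is replaced by $x_1x_2x_3x_4-x_4x_3x_2x_1$ (equivalently, $I\equiv 0$ in every associative algebra with the anti-tetrad as operation). An identity $I$ is a consequence of a set $S$ of identities if every quaternary algebra satisfying all identities in $S$ also satisfies $I$; in degree 4 this means $I$ is a linear combination of the polynomials obtained from those of $S$ by permuting the variables. The symbol $\equiv$ means equality for all values of the arguments. *)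

theory Defs
  imports Complex_Main "HOL-Library.Poly_Mapping"
begin

section \<open>Multilinear quaternary polynomials of degree 4\<close>

datatype var = Va | Vb | Vc | Vd

text \<open>The quadruple \<open>(x1, x2, x3, x4)\<close> stands for the monomial \<open>[x1, x2, x3, x4]\<close>, and a
  polynomial is the finitely supported function giving its rational coefficients. Repeated
  variables are only excluded by \<open>multilinear\<close>.\<close>

type_synonym qmonomial = "var \<times> var \<times> var \<times> var"
type_synonym qpoly = "qmonomial \<Rightarrow>\<^sub>0 rat"

definition multilinear :: "qpoly \<Rightarrow> bool" where
  "multilinear I \<longleftrightarrow> Poly_Mapping.keys I \<subseteq> {(x1, x2, x3, x4). distinct [x1, x2, x3, x4]}"

definition poly_scale :: "rat \<Rightarrow> ('m \<Rightarrow>\<^sub>0 rat) \<Rightarrow> ('m \<Rightarrow>\<^sub>0 rat)" where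
  "poly_scale r p = Poly_Mapping.map ((*) r) p"

lemma lookup_poly_scale [simp]: "Poly_Mapping.lookup (poly_scale r p) m = r * Poly_Mapping.lookup p m"
  by (simp add: poly_scale_def Poly_Mapping.map.rep_eq when_def)

lemma vector_space_poly_scale: "vector_space poly_scale"
  by unfold_locales (auto intro!: poly_mapping_eqI simp: lookup_add algebra_simps)


section \<open>Quaternary algebras, identities and consequences\<close>

locale quaternary_algebra = vector_space scale
  for scale :: "rat \<Rightarrow> 'v::ab_group_add \<Rightarrow> 'v" +
  fixes qop :: "'v \<Rightarrow> 'v \<Rightarrow> 'v \<Rightarrow> 'v \<Rightarrow> 'v"
  assumes linear_1: "Vector_Spaces.linear scale scale (\<lambda>x. qop x y z w)"
    and linear_2: "Vector_Spaces.linear scale scale (\<lambda>y. qop x y z w)"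
    and linear_3: "Vector_Spaces.linear scale scale (\<lambda>z. qop x y z w)"
    and linear_4: "Vector_Spaces.linear scale scale (\<lambda>w. qop x y z w)"

definition qeval ::
  "(rat \<Rightarrow> 'v::ab_group_add \<Rightarrow> 'v) \<Rightarrow> ('v \<Rightarrow> 'v \<Rightarrow> 'v \<Rightarrow> 'v \<Rightarrow> 'v) \<Rightarrow> (var \<Rightarrow> 'v) \<Rightarrow> qpoly \<Rightarrow> 'v"
where
  "qeval scale qop v I =
     (\<Sum>m\<in>Poly_Mapping.keys I. scale (Poly_Mapping.lookup I m)
        (case m of (x1, x2, x3, x4) \<Rightarrow> qop (v x1) (v x2) (v x3) (v x4)))"

definition satisfies ::
  "(rat \<Rightarrow> 'v::ab_group_add \<Rightarrow> 'v) \<Rightarrow> ('v \<Rightarrow> 'v \<Rightarrow> 'v \<Rightarrow> 'v \<Rightarrow> 'v) \<Rightarrow> qpoly \<Rightarrow> bool" where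
  "satisfies scale qop I \<longleftrightarrow> (\<forall>v. qeval scale qop v I = 0)"

text \<open>A HOL formula cannot quantify over types, so the type \<open>'v\<close> of the elements of the test
  algebras is a parameter; in a theorem it is to be a type variable, so that all quaternary
  algebras are covered.\<close>

definition consequence :: "'v::ab_group_add itself \<Rightarrow> qpoly set \<Rightarrow> qpoly \<Rightarrow> bool" where
  "consequence (_ :: 'v itself) S I \<longleftrightarrow>
     (\<forall>(scale :: rat \<Rightarrow> 'v \<Rightarrow> 'v) qop.
        quaternary_algebra scale qop \<longrightarrow> (\<forall>J\<in>S. satisfies scale qop J) \<longrightarrow> satisfies scale qop I)"

text \<open>The degree 4 description of consequences: linear combinations of the polynomials obtained
  by permuting the variables.\<close>

definition permute_vars :: "(var \<Rightarrow> var) \<Rightarrow> qpoly \<Rightarrow> qpoly" where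
  "permute_vars \<sigma> J =
     (\<Sum>m\<in>Poly_Mapping.keys J. Poly_Mapping.single
        (case m of (x1, x2, x3, x4) \<Rightarrow> (\<sigma> x1, \<sigma> x2, \<sigma> x3, \<sigma> x4)) (Poly_Mapping.lookup J m))"

definition linear_consequence :: "qpoly set \<Rightarrow> qpoly \<Rightarrow> bool" where
  "linear_consequence S I \<longleftrightarrow>
     I \<in> module.span poly_scale {permute_vars \<sigma> J | \<sigma> J. bij \<sigma> \<and> J \<in> S}"

definition skew_symmetry :: qpoly where
  "skew_symmetry =
     Poly_Mapping.single (Va, Vb, Vc, Vd) 1 + Poly_Mapping.single (Vd, Vc, Vb, Va) 1"


section \<open>The anti-tetrad and the free associative algebra\<close>

definition anti_tetrad :: "'r::ring \<Rightarrow> 'r \<Rightarrow> 'r \<Rightarrow> 'r \<Rightarrow> 'r" where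
  "anti_tetrad a b c d = a * b * c * d - d * c * b * a"

text \<open>Words under concatenation, written additively because the convolution product on
  finitely supported functions is defined for additive index monoids.\<close>

datatype 'x free_word = Word (letters: "'x list")

instantiation free_word :: (type) monoid_add
begin

definition zero_free_word :: "'a free_word" where
  "zero_free_word = Word []"

definition plus_free_word :: "'a free_word \<Rightarrow> 'a free_word \<Rightarrow> 'a free_word" where
  "plus_free_word u w = Word (letters u @ letters w)"

instance
  by standard (simp_all add: zero_free_word_def plus_free_word_def)

end

type_synonym free_assoc = "var free_word \<Rightarrow>\<^sub>0 rat"

definition generator :: "var \<Rightarrow> free_assoc" where
  "generator x = Poly_Mapping.single (Word [x]) 1"

definition anti_tetrad_identity :: "qpoly \<Rightarrow> bool" where
  "anti_tetrad_identity I \<longleftrightarrow> qeval poly_scale anti_tetrad generator I = 0"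

end

theory Submission
  imports Defs
begin

text \<open>In the expansion of an anti-tetrad polynomial \<open>I\<close>, the word \<open>x1 x2 x3 x4\<close> has coefficient
  \<open>I m - I m'\<close>, where \<open>m = [x1, x2, x3, x4]\<close> and \<open>m'\<close> is its reversal. So \<open>I\<close> is an identity iff
  its coefficients are invariant under reversal, and then \<open>2 I\<close> is the sum of the polynomials
  \<open>I m (m + m')\<close>, where \<open>m + m'\<close> is a renaming of the skew-symmetry.\<close>

lemma UNIV_var: "UNIV = {Va, Vb, Vc, Vd}"
proof -
  have "x \<in> {Va, Vb, Vc, Vd}" for x
    by (cases x) auto
  then show ?thesis by blast
qed

text \<open>Makes \<open>qmonomial\<close> a finite type, so that sums may run over all monomials,
  and lets injective renamings of variables be recognised as bijective.\<close>

instance var :: finite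
  by standard (simp add: UNIV_var)

fun qrev :: "qmonomial \<Rightarrow> qmonomial" where
  "qrev (x1, x2, x3, x4) = (x4, x3, x2, x1)"

lemma qrev_qrev [simp]: "qrev (qrev m) = m"
  by (cases m) simp

lemma bij_qrev: "bij qrev"
  by (rule involuntory_imp_bij) simp

fun qapply :: "('v \<Rightarrow> 'v \<Rightarrow> 'v \<Rightarrow> 'v \<Rightarrow> 'v) \<Rightarrow> (var \<Rightarrow> 'v) \<Rightarrow> qmonomial \<Rightarrow> 'v" where
  "qapply qop v (x1, x2, x3, x4) = qop (v x1) (v x2) (v x3) (v x4)"

fun word_of :: "qmonomial \<Rightarrow> var free_word" where
  "word_of (x1, x2, x3, x4) = Word [x1, x2, x3, x4]"

lemma word_of_eq_iff [simp]: "word_of m = word_of n \<longleftrightarrow> m = n"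
  by (cases m; cases n) auto

text \<open>Monomials outside the support have coefficient 0. The index set \<open>UNIV\<close> does
  not depend on \<open>I\<close> and is stable under \<open>qrev\<close>, which allows
  reindexing.\<close>

lemma qeval_sum_UNIV:
  assumes "vector_space scale"
  shows "qeval scale qop v I
    = (\<Sum>m\<in>UNIV. scale (Poly_Mapping.lookup I m) (qapply qop v m))"
proof -
  interpret vector_space scale by fact
  have "qeval scale qop v I
    = (\<Sum>m\<in>Poly_Mapping.keys I. scale (Poly_Mapping.lookup I m) (qapply qop v m))"
    by (auto simp: qeval_def intro!: sum.cong)
  also have "\<dots> = (\<Sum>m\<in>UNIV. scale (Poly_Mapping.lookup I m) (qapply qop v m))"
    by (rule sum.mono_neutral_left) (auto simp: in_keys_iff)
  finally show ?thesis .
qed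

lemma qapply_anti_tetrad_generator:
  "qapply anti_tetrad generator m
    = Poly_Mapping.single (word_of m) 1 - Poly_Mapping.single (word_of (qrev m)) 1"
  by (cases m) (simp add: anti_tetrad_def generator_def mult_single plus_free_word_def)

lemma lookup_qeval_anti_tetrad:
  "Poly_Mapping.lookup (qeval poly_scale anti_tetrad generator I) (word_of m)
    = Poly_Mapping.lookup I m - Poly_Mapping.lookup I (qrev m)"
proof -
  have qrev_eq_iff: "qrev n = m \<longleftrightarrow> n = qrev m" for n
    by (metis qrev_qrev)
  show ?thesis
    by (simp add: qeval_sum_UNIV[OF vector_space_poly_scale] qapply_anti_tetrad_generator
        lookup_sum lookup_minus lookup_single when_def right_diff_distrib sum_subtractf
        qrev_eq_iff if_distrib[of "(*) _"] cong: if_cong)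
qed

lemma lookup_qrev_of_anti_tetrad_identity:
  assumes "anti_tetrad_identity I"
  shows "Poly_Mapping.lookup I (qrev m) = Poly_Mapping.lookup I m"
  using lookup_qeval_anti_tetrad[of I m] assms by (simp add: anti_tetrad_identity_def)

text \<open>Reindexing along the bijection \<open>qrev\<close>. Doubling avoids choosing one
  monomial from each pair \<open>m\<close>, \<open>qrev m\<close>. With general \<open>scale\<close>
  and \<open>f\<close>, this serves both for values in an algebra and for polynomials
  themselves.\<close>

lemma sum_symmetrize:
  assumes "vector_space scale" "\<And>m. c (qrev m) = c m"
  shows "scale 2 (\<Sum>m\<in>UNIV. scale (c m) (f m)) = (\<Sum>m\<in>UNIV. scale (c m) (f m + f (qrev m)))"
proof -
  interpret vector_space scale by fact
  have "(\<Sum>m\<in>UNIV. scale (c m) (f (qrev m))) = (\<Sum>m\<in>UNIV. scale (c (qrev m)) (f (qrev m)))"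
    by (simp add: assms(2))
  also have "\<dots> = (\<Sum>m\<in>UNIV. scale (c m) (f m))"
    by (rule sum.reindex_bij_betw[OF bij_qrev])
  \<comment> \<open>The instance of \<open>scale_left_distrib\<close> reads
    \<open>scale 2 x = x + x\<close> and is applied from right to left.\<close>
  finally show ?thesis
    by (simp add: scale_right_distrib sum.distrib flip: scale_left_distrib[of 1 1, simplified])
qed

lemma keys_skew_symmetry:
  "Poly_Mapping.keys skew_symmetry = {(Va, Vb, Vc, Vd), (Vd, Vc, Vb, Va)}"
  by (auto simp: skew_symmetry_def in_keys_iff lookup_add lookup_single when_def split: if_splits)

lemma permute_vars_skew_symmetry:
  "permute_vars \<sigma> skew_symmetry = Poly_Mapping.single (\<sigma> Va, \<sigma> Vb, \<sigma> Vc, \<sigma> Vd) 1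
    + Poly_Mapping.single (\<sigma> Vd, \<sigma> Vc, \<sigma> Vb, \<sigma> Va) 1"
  by (simp add: permute_vars_def keys_skew_symmetry)
    (simp add: skew_symmetry_def lookup_add lookup_single)

lemma satisfies_skew_symmetryD:
  assumes "vector_space scale" "satisfies scale qop skew_symmetry"
  shows "qapply qop v m + qapply qop v (qrev m) = 0"
proof (cases m)
  case (fields x1 x2 x3 x4)
  interpret vector_space scale by fact
  \<comment> \<open>The substitution that turns \<open>[a,b,c,d]\<close> into the value of
    \<open>m\<close>. An assignment need not be injective, so entries of \<open>m\<close> may
    coincide.\<close>
  define w where "w = v \<circ> case_var x1 x2 x3 x4"
  have "qeval scale qop w skew_symmetry = 0"
    using assms(2) by (simp add: satisfies_def)
  then show ?thesis
    by (simp add: qeval_def keys_skew_symmetry fields w_def)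
      (simp add: skew_symmetry_def lookup_add lookup_single)
qed

lemma symmetrized_monomial_permute_vars:
  assumes "m \<in> {(x1, x2, x3, x4). distinct [x1, x2, x3, x4]}"
  obtains \<sigma> where "bij \<sigma>"
    "Poly_Mapping.single m 1 + Poly_Mapping.single (qrev m) 1 = permute_vars \<sigma> skew_symmetry"
proof (cases m)
  case (fields x1 x2 x3 x4)
  \<comment> \<open>The renaming sends \<open>Va, Vb, Vc, Vd\<close> to the entries of
    \<open>m\<close>; it is injective because these are distinct.\<close>
  have "inj (case_var x1 x2 x3 x4)"
    using assms by (auto simp: fields inj_on_def split: var.splits)
  then have "bij (case_var x1 x2 x3 x4)"
    by (simp add: bij_def finite_UNIV_inj_surj)
  then show thesis
    by (rule that) (simp add: fields permute_vars_skew_symmetry)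
qed

lemma consequence_skew_symmetry:
  assumes "anti_tetrad_identity I"
  shows "consequence TYPE('v::ab_group_add) {skew_symmetry} I"
  unfolding consequence_def satisfies_def[of _ _ I]
proof (intro allI impI)
  fix scale :: "rat \<Rightarrow> 'v \<Rightarrow> 'v" and qop v
  assume "quaternary_algebra scale qop" and sat: "\<forall>J\<in>{skew_symmetry}. satisfies scale qop J"
  then interpret quaternary_algebra scale qop by simp
  have "scale 2 (qeval scale qop v I)
    = (\<Sum>m\<in>UNIV. scale (Poly_Mapping.lookup I m) (qapply qop v m + qapply qop v (qrev m)))"
    using sum_symmetrize[OF vector_space_axioms] lookup_qrev_of_anti_tetrad_identity[OF assms]
    by (simp add: qeval_sum_UNIV[OF vector_space_axioms])
  also have "\<dots> = 0"
    using sat by (simp add: satisfies_skew_symmetryD[OF vector_space_axioms])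
  \<comment> \<open>The scalar 2 is nonzero in \<open>rat\<close> and cancels.\<close>
  finally show "qeval scale qop v I = 0"
    by simp
qed

lemma linear_consequence_skew_symmetry:
  assumes "multilinear I" "anti_tetrad_identity I"
  shows "linear_consequence {skew_symmetry} I"
proof -
  interpret vector_space poly_scale by (rule vector_space_poly_scale)
  define mono :: "qmonomial \<Rightarrow> qpoly" where "mono m = Poly_Mapping.single m 1" for m
  let ?S = "{permute_vars \<sigma> J | \<sigma> J. bij \<sigma> \<and> J \<in> {skew_symmetry}}"
  have "poly_scale (Poly_Mapping.lookup I m) (mono m + mono (qrev m)) \<in> span ?S" for m
  \<comment> \<open>Multilinearity makes the entries of a monomial in the support distinct, as the
    renaming requires; any other monomial contributes the zero vector.\<close>
  proof (cases "m \<in> Poly_Mapping.keys I")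
    case True
    then have "m \<in> {(x1, x2, x3, x4). distinct [x1, x2, x3, x4]}"
      using assms(1) by (auto simp: multilinear_def)
    then obtain \<sigma> where "bij \<sigma>" "mono m + mono (qrev m) = permute_vars \<sigma> skew_symmetry"
      unfolding mono_def by (rule symmetrized_monomial_permute_vars)
    then show ?thesis
      by (intro span_scale span_base) auto
  next
    case False
    then show ?thesis
      by (simp add: in_keys_iff span_zero)
  qed
  then have "(\<Sum>m\<in>UNIV. poly_scale (Poly_Mapping.lookup I m) (mono m + mono (qrev m))) \<in> span ?S"
    by (intro span_sum)
  \<comment> \<open>Expansion in the monomial basis, which brings \<open>I\<close> into the form
    treated by \<open>sum_symmetrize\<close> with \<open>f = mono\<close>.\<close>
  moreover have "I = (\<Sum>m\<in>UNIV. poly_scale (Poly_Mapping.lookup I m) (mono m))"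
    by (rule poly_mapping_eqI)
      (simp add: mono_def lookup_sum lookup_single when_def if_distrib[of "(*) _"] cong: if_cong)
  ultimately have "poly_scale 2 I \<in> span ?S"
    using sum_symmetrize[OF vector_space_poly_scale, of "Poly_Mapping.lookup I" mono]
      lookup_qrev_of_anti_tetrad_identity[OF assms(2)] by simp
  then have "poly_scale (1 / 2) (poly_scale 2 I) \<in> span ?S"
    by (rule span_scale)
  then show ?thesis
    by (simp add: linear_consequence_def)
qed

theorem lemma6p1:
  fixes I :: qpoly
  assumes "multilinear I"
    and "anti_tetrad_identity I"
  shows "consequence TYPE('v::ab_group_add) {skew_symmetry} I
    \<and> linear_consequence {skew_symmetry} I"
  using assms by (simp add: consequence_skew_symmetry linear_consequence_skew_symmetry)

end
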